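(* Let $p(x)=x^n+a_{n-1}x^{n-1}+\cdots+a_1x+a_0$ be a monic complex polynomial of degree $n\ge 1$. Let $\mathcal{F}$ be the Frobenius companion matrix of $p$ and let $C\neq \mathcal{F}$ be a unit sparse companion matrix of $p$. Then $N(\mathcal{F})<2N(C)$ and $N(\mathcal{F})-N(C)\le 1$. Moreover, the latter inequality is strict if $a_0\neq 0$.
   Context: For an $n\times n$ complex matrix $A=[a_{ij}]$, $\|A\|_\infty=\max_i\sum_j|a_{ij}|$, $\|A\|_1=\max_j\sum_i|a_{ij}|$, and $N(A)=\min\{\|A\|_\infty,\|A\|_1\}$. The Frobenius companion matrix $\mathcal{F}$ of $p$ is the $n\times n$ matrix with $1$ in each position $(i,i+1)$, $1\le i\le n-1$, last row $(-a_0,-a_1,\ldots,-a_{n-1})$, and all other entries $0$. A companion matrix of $p$ is an $n\times n$ matrix with $n^2-n$ constant entries and whose remaining $n$ entries are the variables $-a_0,\ldots,-a_{n-1}$, such that its characteristic polynomial is $p$ identically in the $a_k$. It is sparse if it has exactly $2n-1$ nonzero entries (counting the variables as nonzero), and unit sparse if in addition the $n-1$ nonzero constant entries all equal $1$. Two matrices are equivalent if one is obtained from the other by permutation similarity and/or transposition. It is known (and may be taken as the definition) that a matrix is a unit sparse companion matrix of $p$ if and only if it is equivalent to a matrix $C$ in the following Hessenberg form: for some $0\le m\le n-1$, $C$ has $1$ in each position $(i,i+1)$, $1\le i\le n-1$; for each $k\in\{0,\ldots,n-1\}$ the entry $-a_{k}$ is placed in exactly one position $(i,j)$ with $m+1\le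 i\le n$, $1\le j\le m+1$ and $i-j=n-1-k$; all other entries are $0$. (The variables $a_k$ are then replaced by the actual coefficients of the given polynomial, which may be zero.) *)

theory Defs
  imports "Jordan_Normal_Form.Matrix" "HOL-Computational_Algebra.Polynomial"
    "HOL-Combinatorics.Permutations"
begin

text \<open>Matrices are indexed from \<open>0\<close>: the mathematical position \<open>(i, j)\<close> is \<open>(i - 1, j - 1)\<close> here.

  A companion matrix is a matrix whose entries are complex constants and the variables
  \<open>-a\<^sub>k\<close>; it is kept as a matrix of formal entries, so that two companion matrices
  with the variables in different places are different even when they happen to agree for the
  coefficients of a particular polynomial.\<close>

datatype centry = Const complex | NegCoeff nat

primrec centry_val :: "complex poly \<Rightarrow> centry \<Rightarrow> complex" where
  "centry_val p (Const c) = c"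
| "centry_val p (NegCoeff k) = - coeff p k"

definition instantiate :: "complex poly \<Rightarrow> centry mat \<Rightarrow> complex mat" where
  "instantiate p C = map_mat (centry_val p) C"

definition frobenius_companion :: "nat \<Rightarrow> centry mat" where
  "frobenius_companion n = mat n n (\<lambda>(i, j).
     if i = n - 1 then NegCoeff j else if j = i + 1 then Const 1 else Const 0)"

definition perm_similar_mat :: "(nat \<Rightarrow> nat) \<Rightarrow> 'a mat \<Rightarrow> 'a mat" where
  "perm_similar_mat \<pi> A = mat (dim_row A) (dim_col A) (\<lambda>(i, j). A $$ (\<pi> i, \<pi> j))"

definition equivalent_mat :: "nat \<Rightarrow> 'a mat \<Rightarrow> 'a mat \<Rightarrow> bool" where
  "equivalent_mat n A B \<longleftrightarrow> A \<in> carrier_mat n n \<and> B \<in> carrier_mat n n \<and>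
     (\<exists>\<pi>. \<pi> permutes {..<n} \<and>
       (B = perm_similar_mat \<pi> A \<or> B = transpose_mat (perm_similar_mat \<pi> A)))"

text \<open>The placement of \<open>-a\<^sub>k\<close> is given by \<open>(r k, c k)\<close>. The condition \<open>i - j = n - 1 - k\<close>
  is written additively; it makes the positions for different \<open>k\<close> distinct, and rows \<open>\<ge> m\<close>
  with columns \<open>\<le> m\<close> do not meet the superdiagonal.\<close>

definition hessenberg_companion :: "nat \<Rightarrow> centry mat \<Rightarrow> bool" where
  "hessenberg_companion n C \<longleftrightarrow> C \<in> carrier_mat n n \<and>
     (\<exists>m r c. m < n \<and>
       (\<forall>k<n. m \<le> r k \<and> r k < n \<and> c k \<le> m \<and> r k = c k + (n - 1 - k)) \<and>
       (\<forall>i. i + 1 < n \<longrightarrow> C $$ (i, i + 1) = Const 1) \<and>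
       (\<forall>k<n. C $$ (r k, c k) = NegCoeff k) \<and>
       (\<forall>i<n. \<forall>j<n. j \<noteq> i + 1 \<and> (\<forall>k<n. (i, j) \<noteq> (r k, c k)) \<longrightarrow> C $$ (i, j) = Const 0))"

text \<open>Unit sparse companion matrices are defined through the known classification: they are
  exactly the matrices equivalent to one of the above Hessenberg form.\<close>

definition unit_sparse_companion :: "nat \<Rightarrow> centry mat \<Rightarrow> bool" where
  "unit_sparse_companion n C \<longleftrightarrow> (\<exists>H. hessenberg_companion n H \<and> equivalent_mat n H C)"

definition mat_norm_inf :: "complex mat \<Rightarrow> real" where
  "mat_norm_inf A = Max ((\<lambda>i. \<Sum>j<dim_col A. cmod (A $$ (i, j))) ` {..<dim_row A})"

definition mat_norm_1 :: "complex mat \<Rightarrow> real" where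
  "mat_norm_1 A = Max ((\<lambda>j. \<Sum>i<dim_row A. cmod (A $$ (i, j))) ` {..<dim_col A})"

definition mat_N :: "complex mat \<Rightarrow> real" where
  "mat_N A = min (mat_norm_inf A) (mat_norm_1 A)"

end

(* Writing a k = |a_k|, one has N(F) <= max(a 0, 1 + max_{k >= 1} a k) and N(F) <= max(1, sum a k).
   Conversely the row sum norm R of a Hessenberg companion matrix satisfies 1 <= R, a 0 <= R and,
   for 1 <= k, either 1 + a k <= R or a 0 + a k <= R: a variable outside the last row shares its row
   with a superdiagonal 1, one in the last row shares it with a_0. This bounds N(F) - R. Since
   N(F) <= 1 + R, the bound N(F) < 2 R could fail only if R = 1, in which case every nonzero
   coefficient lies in the last row and N(F) <= max(1, sum a k) <= R.
   Reflection in the antidiagonal preserves the Hessenberg form and exchanges the two norms. *)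

theory Submission imports Defs begin

section \<open>Substituting the coefficients, transposing and permuting indices\<close>

lemma dim_perm_similar_mat [simp]:
  "dim_row (perm_similar_mat \<pi> A) = dim_row A" "dim_col (perm_similar_mat \<pi> A) = dim_col A"
  by (simp_all add: perm_similar_mat_def)

lemma dim_instantiate [simp]:
  "dim_row (instantiate p A) = dim_row A" "dim_col (instantiate p A) = dim_col A"
  by (simp_all add: instantiate_def)

lemma index_instantiate [simp]:
  "i < dim_row A \<Longrightarrow> j < dim_col A \<Longrightarrow> instantiate p A $$ (i, j) = centry_val p (A $$ (i, j))"
  by (simp add: instantiate_def)

lemma instantiate_transpose_mat:
  "instantiate p (transpose_mat A) = transpose_mat (instantiate p A)"
  by (rule eq_matI) auto

text \<open>Entries outside the dimensions are unspecified, so the argument needs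
  \<open>\<pi>\<close> to keep every index below \<open>n\<close>.\<close>

lemma instantiate_perm_similar_mat:
  assumes "A \<in> carrier_mat n n" and "\<pi> permutes {..<n}"
  shows "instantiate p (perm_similar_mat \<pi> A) = perm_similar_mat \<pi> (instantiate p A)"
proof -
  have "\<pi> i < n" if "i < n" for i
    using permutes_in_image[OF assms(2), of i] that by simp
  with assms(1) show ?thesis
    by (intro eq_matI) (auto simp: perm_similar_mat_def)
qed

section \<open>Behaviour of the two norms under equivalence\<close>

lemma mat_norm_inf_transpose: "mat_norm_inf (transpose_mat A) = mat_norm_1 A"
  by (auto simp: mat_norm_inf_def mat_norm_1_def intro!: arg_cong[where f = Max] image_cong sum.cong)

lemma mat_norm_1_transpose: "mat_norm_1 (transpose_mat A) = mat_norm_inf A"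
  using mat_norm_inf_transpose[of "transpose_mat A"] by simp

text \<open>Permuting columns reorders the terms of each row sum; permuting rows then only reorders
  the row sums over which the maximum is taken.\<close>

lemma mat_norm_inf_perm_similar:
  assumes A: "A \<in> carrier_mat n n" and \<pi>: "\<pi> permutes {..<n}"
  shows "mat_norm_inf (perm_similar_mat \<pi> A) = mat_norm_inf A"
proof -
  have "(\<Sum>j<n. cmod (perm_similar_mat \<pi> A $$ (i, j))) = (\<Sum>j<n. cmod (A $$ (\<pi> i, j)))"
    if "i < n" for i
  proof -
    have "(\<Sum>j<n. cmod (perm_similar_mat \<pi> A $$ (i, j))) = (\<Sum>j<n. cmod (A $$ (\<pi> i, \<pi> j)))"
      using A that by (intro sum.cong) (auto simp: perm_similar_mat_def)
    also have "\<dots> = (\<Sum>j<n. cmod (A $$ (\<pi> i, j)))"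
      using sum.permute[OF \<pi>, of "\<lambda>j. cmod (A $$ (\<pi> i, j))"] by (simp add: o_def)
    finally show ?thesis .
  qed
  then have "(\<lambda>i. \<Sum>j<n. cmod (perm_similar_mat \<pi> A $$ (i, j))) ` {..<n}
      = (\<lambda>i. \<Sum>j<n. cmod (A $$ (i, j))) ` (\<pi> ` {..<n})"
    by (simp add: image_image)
  then show ?thesis
    using A by (simp add: mat_norm_inf_def permutes_image[OF \<pi>])
qed

lemma mat_norm_1_perm_similar:
  assumes A: "A \<in> carrier_mat n n" and \<pi>: "\<pi> permutes {..<n}"
  shows "mat_norm_1 (perm_similar_mat \<pi> A) = mat_norm_1 A"
proof -
  have "\<pi> i < n" if "i < n" for i
    using permutes_in_image[OF \<pi>, of i] that by simp
  with A have "transpose_mat (perm_similar_mat \<pi> A) = perm_similar_mat \<pi> (transpose_mat A)"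
    by (intro eq_matI) (auto simp: perm_similar_mat_def)
  then show ?thesis
    using mat_norm_inf_perm_similar[of "transpose_mat A", OF _ \<pi>] A
    by (simp flip: mat_norm_inf_transpose)
qed

text \<open>Permutation similarity fixes both norms and transposition swaps them, which their
  minimum does not notice. This reduces the theorem to Hessenberg form.\<close>

lemma mat_N_instantiate_equivalent:
  assumes "equivalent_mat n A B"
  shows "mat_N (instantiate p B) = mat_N (instantiate p A)"
proof -
  from assms obtain \<pi> where A: "A \<in> carrier_mat n n" and \<pi>: "\<pi> permutes {..<n}"
    and B: "B = perm_similar_mat \<pi> A \<or> B = transpose_mat (perm_similar_mat \<pi> A)"
    unfolding equivalent_mat_def by blast
  let ?P = "instantiate p (perm_similar_mat \<pi> A)"
  have I: "instantiate p A \<in> carrier_mat n n" using A by auto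
  have "mat_norm_inf ?P = mat_norm_inf (instantiate p A)"
    "mat_norm_1 ?P = mat_norm_1 (instantiate p A)"
    using mat_norm_inf_perm_similar[OF I \<pi>] mat_norm_1_perm_similar[OF I \<pi>]
    by (simp_all only: instantiate_perm_similar_mat[OF A \<pi>])
  with B show ?thesis
    unfolding mat_N_def
    by (elim disjE)
      (simp_all only: instantiate_transpose_mat mat_norm_inf_transpose mat_norm_1_transpose
        min.commute)
qed

section \<open>Lower bounds for the row sum norm from single entries and pairs\<close>

lemma row_sum_le_mat_norm_inf:
  assumes "A \<in> carrier_mat n n" and "i < n"
  shows "(\<Sum>j<n. cmod (A $$ (i, j))) \<le> mat_norm_inf A"
  using assms by (auto simp: mat_norm_inf_def intro!: Max_ge)

lemma entry_le_mat_norm_inf: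
  assumes "A \<in> carrier_mat n n" and "i < n" and "j < n"
  shows "cmod (A $$ (i, j)) \<le> mat_norm_inf A"
  using assms member_le_sum[of j "{..<n}" "\<lambda>j. cmod (A $$ (i, j))"]
    row_sum_le_mat_norm_inf[OF assms(1,2)] by auto

lemma two_entries_le_mat_norm_inf:
  assumes "A \<in> carrier_mat n n" and "i < n" and "j < n" and "k < n" and "j \<noteq> k"
  shows "cmod (A $$ (i, j)) + cmod (A $$ (i, k)) \<le> mat_norm_inf A"
proof -
  have "(\<Sum>l\<in>{j, k}. cmod (A $$ (i, l))) \<le> (\<Sum>l<n. cmod (A $$ (i, l)))"
    using assms by (intro sum_mono2) auto
  with row_sum_le_mat_norm_inf[OF assms(1,2)] assms(5) show ?thesis by simp
qed

section \<open>The Hessenberg form and its reflection\<close>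

lemma hessenberg_companionI:
  assumes "H \<in> carrier_mat n n" and "m < n"
    and "\<And>k. k < n \<Longrightarrow> m \<le> r k \<and> r k < n \<and> c k \<le> m \<and> r k = c k + (n - 1 - k)"
    and "\<And>i. i + 1 < n \<Longrightarrow> H $$ (i, i + 1) = Const 1"
    and "\<And>k. k < n \<Longrightarrow> H $$ (r k, c k) = NegCoeff k"
    and "\<And>i j. \<lbrakk>i < n; j < n; j \<noteq> i + 1; \<And>k. k < n \<Longrightarrow> (i, j) \<noteq> (r k, c k)\<rbrakk>
      \<Longrightarrow> H $$ (i, j) = Const 0"
  shows "hessenberg_companion n H"
proof -
  have "\<forall>i<n. \<forall>j<n. j \<noteq> i + 1 \<and> (\<forall>k<n. (i, j) \<noteq> (r k, c k)) \<longrightarrow> H $$ (i, j) = Const 0"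
    using assms(6) by blast
  moreover have "\<forall>k<n. m \<le> r k \<and> r k < n \<and> c k \<le> m \<and> r k = c k + (n - 1 - k)"
    using assms(3) by blast
  moreover have "\<forall>i. i + 1 < n \<longrightarrow> H $$ (i, i + 1) = Const 1"
    using assms(4) by blast
  moreover have "\<forall>k<n. H $$ (r k, c k) = NegCoeff k"
    using assms(5) by blast
  ultimately show ?thesis
    unfolding hessenberg_companion_def using assms(1,2)
    by (intro conjI exI[of _ m] exI[of _ r] exI[of _ c])
qed

text \<open>The map sending (i, j) to (n - 1 - j, n - 1 - i) preserves i - j, so the superdiagonal
  and the diagonal assigned to each variable are mapped to themselves. The block of rows from
  \<open>m\<close> on and columns up to \<open>m\<close> becomes the one for
  \<open>n - 1 - m\<close>.\<close>

lemma hessenberg_reflect: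
  assumes H: "hessenberg_companion n H" and \<pi>: "\<And>i. i < n \<Longrightarrow> \<pi> i = n - 1 - i"
  shows "hessenberg_companion n (transpose_mat (perm_similar_mat \<pi> H))"
proof -
  from H obtain m r c where C: "H \<in> carrier_mat n n" and m: "m < n"
    and rc': "\<forall>k<n. m \<le> r k \<and> r k < n \<and> c k \<le> m \<and> r k = c k + (n - 1 - k)"
    and one': "\<forall>i. i + 1 < n \<longrightarrow> H $$ (i, i + 1) = Const 1"
    and coef': "\<forall>k<n. H $$ (r k, c k) = NegCoeff k"
    and zero': "\<forall>i<n. \<forall>j<n. j \<noteq> i + 1 \<and> (\<forall>k<n. (i, j) \<noteq> (r k, c k))
      \<longrightarrow> H $$ (i, j) = Const 0"
    unfolding hessenberg_companion_def by (elim conjE exE) (rule that)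
  note rc = rc'[rule_format] and one = one'[rule_format] and coef = coef'[rule_format]
  have zero: "H $$ (i, j) = Const 0"
    if "i < n" "j < n" "j \<noteq> i + 1" "\<And>k. k < n \<Longrightarrow> (i, j) \<noteq> (r k, c k)" for i j
    using zero'[rule_format, of i j] that by blast
  let ?T = "transpose_mat (perm_similar_mat \<pi> H)"
  have T: "?T $$ (i, j) = H $$ (n - 1 - j, n - 1 - i)" if "i < n" "j < n" for i j
    using that C by (simp add: perm_similar_mat_def \<pi>)
  show ?thesis
  proof (rule hessenberg_companionI[where m = "n - 1 - m" and r = "\<lambda>k. n - 1 - c k"
        and c = "\<lambda>k. n - 1 - r k"])
    show "?T \<in> carrier_mat n n" using C by auto
    show "n - 1 - m < n" using m by simp
    show "n - 1 - m \<le> n - 1 - c k \<and> n - 1 - c k < n \<and> n - 1 - r k \<le> n - 1 - m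
      \<and> n - 1 - c k = n - 1 - r k + (n - 1 - k)" if "k < n" for k
      using rc[OF that] that by linarith
    show "?T $$ (i, i + 1) = Const 1" if "i + 1 < n" for i
    proof -
      have e: "n - 1 - i = n - 1 - (i + 1) + 1" and lt: "n - 1 - (i + 1) + 1 < n"
        using that by linarith+
      have "H $$ (n - 1 - (i + 1), n - 1 - i) = Const 1"
        using one[OF lt] by (simp only: e)
      with T[of i "i + 1"] that show ?thesis by simp
    qed
    show "?T $$ (n - 1 - c k, n - 1 - r k) = NegCoeff k" if "k < n" for k
    proof -
      have "n - 1 - (n - 1 - r k) = r k" "n - 1 - (n - 1 - c k) = c k"
        "n - 1 - c k < n" "n - 1 - r k < n"
        using rc[OF that] m by linarith+
      with coef[OF that] T[of "n - 1 - c k" "n - 1 - r k"] show ?thesis by simp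
    qed
    show "?T $$ (i, j) = Const 0"
      if ij: "i < n" "j < n" "j \<noteq> i + 1"
        and other: "\<And>k. k < n \<Longrightarrow> (i, j) \<noteq> (n - 1 - c k, n - 1 - r k)" for i j
    proof -
      have "(n - 1 - j, n - 1 - i) \<noteq> (r k, c k)" if "k < n" for k
      proof
        assume "(n - 1 - j, n - 1 - i) = (r k, c k)"
        then have "n - 1 - j = r k" "n - 1 - i = c k" by simp_all
        with ij have "i = n - 1 - c k" "j = n - 1 - r k" by linarith+
        with other[OF that] show False by simp
      qed
      moreover have "n - 1 - j < n" "n - 1 - i < n" "n - 1 - i \<noteq> n - 1 - j + 1"
        using ij by linarith+
      ultimately show ?thesis
        using zero[of "n - 1 - j" "n - 1 - i"] T[OF ij(1,2)] by simp
    qed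
  qed
qed

section \<open>Upper bounds for the two norms of the Frobenius matrix\<close>

lemma mat_norm_1_frobenius_le:
  assumes "n \<ge> 1"
  obtains j where "j < n" and "mat_norm_1 (instantiate p (frobenius_companion n))
    \<le> cmod (coeff p j) + (if j = 0 then 0 else 1)"
proof -
  let ?F = "instantiate p (frobenius_companion n)"
  have F: "frobenius_companion n \<in> carrier_mat n n" by (simp add: frobenius_companion_def)
  have "mat_norm_1 ?F \<in> (\<lambda>j. \<Sum>i<n. cmod (?F $$ (i, j))) ` {..<n}"
    unfolding mat_norm_1_def using F assms by (auto simp: lessThan_empty_iff intro!: Max_in)
  then obtain j where j: "j < n" "mat_norm_1 ?F = (\<Sum>i<n. cmod (?F $$ (i, j)))" by blast
  \<comment> \<open>Column \<open>j\<close> holds its variable in the last row and a 1 in row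
    \<open>j - 1\<close>. Column 0 has no such 1: there the truncated \<open>j - 1\<close> is 0, and
    the inner conditional removes the spurious term.\<close>
  have "(\<Sum>i<n. cmod (?F $$ (i, j)))
      \<le> (\<Sum>i<n. (if i = n - 1 then cmod (coeff p j) else 0)
               + (if i = j - 1 then if j = 0 then 0 else 1 else 0))"
    using F j(1) by (intro sum_mono) (auto simp: frobenius_companion_def)
  also have "\<dots> = cmod (coeff p j) + (if j = 0 then 0 else 1)"
    using j(1) by (auto simp: sum.distrib)
  finally show thesis using j that by simp
qed

lemma mat_norm_inf_frobenius_le:
  assumes "n \<ge> 1"
  shows "mat_norm_inf (instantiate p (frobenius_companion n)) \<le> max 1 (\<Sum>k<n. cmod (coeff p k))"
proof -
  let ?F = "instantiate p (frobenius_companion n)"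
  have F: "frobenius_companion n \<in> carrier_mat n n" by (simp add: frobenius_companion_def)
  have "(\<Sum>j<n. cmod (?F $$ (i, j))) \<le> max 1 (\<Sum>k<n. cmod (coeff p k))" if "i < n" for i
  proof (cases "i = n - 1")
    case True
    then show ?thesis using that F by (simp add: frobenius_companion_def)
  next
    case False
    then have "(\<Sum>j<n. cmod (?F $$ (i, j))) = (\<Sum>j<n. if j = i + 1 then 1 else 0)"
      using that F by (intro sum.cong) (auto simp: frobenius_companion_def)
    also have "\<dots> \<le> 1" by simp
    finally show ?thesis by simp
  qed
  then show ?thesis
    unfolding mat_norm_inf_def using F assms by (auto simp: lessThan_empty_iff intro!: Max.boundedI)
qed

text \<open>Only the row sum norm of \<open>H\<close> is treated; applying the result to the
  reflected matrix covers the column sum norm. The condition \<open>n \<ge> 2\<close> supplies a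
  superdiagonal 1, hence \<open>1 \<le> R\<close>.\<close>

lemma frobenius_bounds_mat_norm_inf_hessenberg:
  fixes p :: "complex poly"
  assumes n: "n \<ge> 2" and H: "hessenberg_companion n H"
  defines "N \<equiv> mat_N (instantiate p (frobenius_companion n))"
    and "R \<equiv> mat_norm_inf (instantiate p H)"
  shows "N < 2 * R \<and> N - R \<le> 1 \<and> (coeff p 0 \<noteq> 0 \<longrightarrow> N - R < 1)"
proof -
  from H obtain m r c where C: "H \<in> carrier_mat n n" and m: "m < n"
    and rc': "\<forall>k<n. m \<le> r k \<and> r k < n \<and> c k \<le> m \<and> r k = c k + (n - 1 - k)"
    and one': "\<forall>i. i + 1 < n \<longrightarrow> H $$ (i, i + 1) = Const 1"
    and coef': "\<forall>k<n. H $$ (r k, c k) = NegCoeff k"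
    unfolding hessenberg_companion_def by (elim conjE exE) (rule that)
  note rc = rc'[rule_format] and one = one'[rule_format] and coef = coef'[rule_format]
  define a where "a k = cmod (coeff p k)" for k
  let ?A = "instantiate p H"
  have A: "?A \<in> carrier_mat n n" using C by auto
  have a0: "cmod (?A $$ (n - 1, 0)) = a 0"
  proof -
    \<comment> \<open>For k = 0 the difference of the indices is n - 1, which only the bottom left
      corner attains.\<close>
    have "r 0 = n - 1" "c 0 = 0" using rc[of 0] n by auto
    then show ?thesis using coef[of 0] C n by (simp add: a_def)
  qed
  have super: "cmod (?A $$ (i, i + 1)) = 1" if "i + 1 < n" for i
    using one[OF that] that C by simp
  have ak: "cmod (?A $$ (r k, c k)) = a k" if "k < n" for k
    using coef[OF that] rc[OF that] m C by (simp add: a_def)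
  have last: "c k = k" if "k < n" "r k = n - 1" for k
    using rc[OF that(1)] that by linarith
  have R1: "1 \<le> R"
    using entry_le_mat_norm_inf[OF A, of 0 1] super[of 0] n by (simp add: R_def)
  have R0: "a 0 \<le> R"
    using entry_le_mat_norm_inf[OF A, of "n - 1" 0] a0 n by (simp add: R_def)
  have Rsuper: "1 + a k \<le> R" if "k < n" "r k \<noteq> n - 1" for k
  proof -
    \<comment> \<open>Since \<open>c k \<le> m \<le> r k\<close>, the variable and the superdiagonal
      1 of its row occupy different columns.\<close>
    have *: "r k + 1 < n" "c k < n" "c k \<noteq> r k + 1" using rc[OF that(1)] that m by auto
    show ?thesis
      using two_entries_le_mat_norm_inf[OF A, of "r k" "r k + 1" "c k"] * super[OF *(1)] ak[OF that(1)]
      by (simp add: R_def)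
  qed
  have Rlast: "a 0 + a k \<le> R" if "k < n" "k \<noteq> 0" "r k = n - 1" for k
    using two_entries_le_mat_norm_inf[OF A, of "n - 1" 0 k] that a0 ak[OF that(1)] last[OF that(1,3)]
    by (simp add: R_def)
  have a_nonneg: "0 \<le> a k" for k by (simp add: a_def)
  \<comment> \<open>\<open>j\<close> is a column of the Frobenius matrix with the largest sum; the
    cases below ask where \<open>H\<close> places the variable of that column.\<close>
  obtain j where j: "j < n" "N \<le> a j + (if j = 0 then 0 else 1)"
    using mat_norm_1_frobenius_le[of n p] n unfolding N_def mat_N_def a_def
    by (metis (no_types, lifting) Suc_1 Suc_leD min.coboundedI2)
  consider "j = 0" | "j \<noteq> 0" "r j \<noteq> n - 1" | "j \<noteq> 0" "r j = n - 1"
    by blast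
  then have bound: "N \<le> R + 1 \<and> (0 < a 0 \<longrightarrow> N < R + 1)"
  proof cases
    case 1
    with j R0 R1 show ?thesis by simp
  next
    case 2
    with j Rsuper[of j] show ?thesis by simp
  next
    \<comment> \<open>Here N <= 1 + a j <= 1 + R - a 0. This is the only case in which N may exceed
      R, and the excess is below 1 as soon as a 0 is positive.\<close>
    case 3
    with j Rlast[of j] a_nonneg[of 0] show ?thesis by simp
  qed
  moreover have "0 < a 0" if "coeff p 0 \<noteq> 0"
    using that by (simp add: a_def)
  moreover have "N < 2 * R"
  proof (cases "R = 1")
    case False
    with bound R1 show ?thesis by simp
  next
    case True
    \<comment> \<open>A variable in the last row of \<open>H\<close> stands in column
      \<open>k\<close>, as in the Frobenius matrix; any other has 1 + a k <= R = 1, so its value is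
      zero.\<close>
    have "a k \<le> cmod (?A $$ (n - 1, k))" if "k < n" for k
    proof (cases "r k = n - 1")
      case True
      then show ?thesis using ak[OF that] last[OF that True] by simp
    next
      case False
      with Rsuper[OF that] \<open>R = 1\<close> have "a k \<le> 0" by simp
      then show ?thesis using norm_ge_zero order_trans by blast
    qed
    then have "(\<Sum>k<n. a k) \<le> (\<Sum>k<n. cmod (?A $$ (n - 1, k)))"
      by (intro sum_mono) auto
    also have "\<dots> \<le> 1"
      using row_sum_le_mat_norm_inf[OF A, of "n - 1"] n True by (simp add: R_def)
    \<comment> \<open>This time the row sum norm of the Frobenius matrix bounds N.\<close>
    finally have "N \<le> 1"
      using mat_norm_inf_frobenius_le[of n p] n by (simp add: N_def mat_N_def a_def)
    with True show ?thesis by simp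
  qed
  ultimately show ?thesis by auto
qed

section \<open>Excluding n = 1, and the theorem\<close>

lemma unit_sparse_companion_1:
  assumes "unit_sparse_companion 1 C"
  shows "C = frobenius_companion 1"
proof -
  from assms obtain H where H: "hessenberg_companion 1 H" and HC: "equivalent_mat 1 H C"
    by (auto simp: unit_sparse_companion_def)
  from H have "H \<in> carrier_mat 1 1" and "H $$ (0, 0) = NegCoeff 0"
    by (auto simp: hessenberg_companion_def)
  moreover obtain \<pi> where "\<pi> permutes {..<1::nat}"
    and "C = perm_similar_mat \<pi> H \<or> C = transpose_mat (perm_similar_mat \<pi> H)"
    using HC by (auto simp: equivalent_mat_def)
  moreover from this(1) have "\<pi> 0 = 0"
    using permutes_in_image[of \<pi> "{..<1}" 0] by simp
  ultimately show ?thesis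
    by (intro eq_matI) (auto simp: frobenius_companion_def perm_similar_mat_def)
qed

theorem theorem3p4:
  fixes p :: "complex poly" and n :: nat and C :: "centry mat"
  assumes "n \<ge> 1" and "degree p = n" and "lead_coeff p = 1"
    and "unit_sparse_companion n C"
    and "C \<noteq> frobenius_companion n"
  shows "mat_N (instantiate p (frobenius_companion n)) < 2 * mat_N (instantiate p C)
    \<and> mat_N (instantiate p (frobenius_companion n)) - mat_N (instantiate p C) \<le> 1
    \<and> (coeff p 0 \<noteq> 0 \<longrightarrow>
        mat_N (instantiate p (frobenius_companion n)) - mat_N (instantiate p C) < 1)"
proof -
  from assms(4) obtain H where H: "hessenberg_companion n H" and HC: "equivalent_mat n H C"
    by (auto simp: unit_sparse_companion_def)
  \<comment> \<open>For n = 1 the Frobenius matrix is the only candidate, and N(F) < 2 N(F) would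
    fail when the constant coefficient is 0.\<close>
  have n: "n \<ge> 2"
    using assms(1,4,5) unit_sparse_companion_1[of C] by (cases "n = 1") auto
  have carrier: "H \<in> carrier_mat n n" using H by (simp add: hessenberg_companion_def)
  \<comment> \<open>The reversal of the indices, its own inverse; \<open>permutes\<close> demands
    the identity outside the range.\<close>
  define \<pi> where "\<pi> i = (if i < n then n - 1 - i else i)" for i
  have \<pi>: "\<pi> permutes {..<n}"
    by (rule bij_imp_permutes, rule bij_betwI[where g = \<pi>]) (auto simp: \<pi>_def)
  let ?T = "transpose_mat (perm_similar_mat \<pi> H)"
  have T: "hessenberg_companion n ?T"
    using H by (rule hessenberg_reflect) (simp add: \<pi>_def)
  have "instantiate p H \<in> carrier_mat n n" using carrier by auto
  with \<pi> carrier have "mat_norm_inf (instantiate p ?T) = mat_norm_1 (instantiate p H)"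
    by (simp add: instantiate_transpose_mat instantiate_perm_similar_mat mat_norm_inf_transpose
        mat_norm_1_perm_similar)
  \<comment> \<open>N(C) = N(H) is one of the two norms of \<open>H\<close>, and the bounds hold for
    each: directly for the row sums, through the reflected matrix for the column sums.\<close>
  then show ?thesis
    using frobenius_bounds_mat_norm_inf_hessenberg[OF n H, of p]
      frobenius_bounds_mat_norm_inf_hessenberg[OF n T, of p]
    unfolding mat_N_instantiate_equivalent[OF HC] mat_N_def[of "instantiate p H"]
    by (simp add: min_def split: if_splits)
qed

end
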